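(* Let $n\geq 3$ and let $\alpha\in\mathcal{PT}_n$. Then $\alpha\in\mathcal{DPC}_n$ if and only if there exists $\sigma\in\mathcal{D}_{2n}$ such that $\alpha=\sigma|_{\mathrm{Dom}(\alpha)}$. Furthermore, for $\alpha\in\mathcal{DPC}_n$, one has: (1) If either $|\mathrm{Dom}(\alpha)|=1$, or $|\mathrm{Dom}(\alpha)|=2$ and $\mathrm{d}(\min\mathrm{Dom}(\alpha),\max\mathrm{Dom}(\alpha))=\frac n2$ (in which case $n$ is even), then there exist exactly two (distinct) permutations $\sigma,\sigma'\in\mathcal{D}_{2n}$ such that $\alpha=\sigma|_{\mathrm{Dom}(\alpha)}=\sigma'|_{\mathrm{Dom}(\alpha)}$. (2) If either $|\mathrm{Dom}(\alpha)|=2$ and $\mathrm{d}(\min\mathrm{Dom}(\alpha),\max\mathrm{Dom}(\alpha))\neq\frac n2$, or $|\mathrm{Dom}(\alpha)|\geq 3$, then there exists exactly one permutation $\sigma\in\mathcal{D}_{2n}$ such that $\alpha=\sigma|_{\mathrm{Dom}(\alpha)}$.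
   Context: $\mathcal{PT}_n$ is the monoid, under composition, of all partial transformations of $\{1,2,\ldots,n\}$ (including the empty one); maps are written on the right and composed from left to right. For $n\geq3$, $C_n$ is the cycle graph with vertex set $\{1,\ldots,n\}$ and edges $\{i,i+1\}$ ($1\leq i\leq n-1$) and $\{1,n\}$; $\mathrm{d}(x,y)$ is the geodesic distance in $C_n$, i.e. $\mathrm{d}(x,y)=\min\{|x-y|,n-|x-y|\}$. $\mathcal{DPC}_n$ is the monoid of all partial isometries of $C_n$, i.e. of all $\alpha\in\mathcal{PT}_n$ such that $\mathrm{d}(x\alpha,y\alpha)=\mathrm{d}(x,y)$ for all $x,y\in\mathrm{Dom}(\alpha)$. $\mathcal{D}_{2n}$ is the dihedral group of order $2n$, realized as the group of permutations of $\{1,\ldots,n\}$ generated by $g$ ($ig=i+1$ for $i<n$, $ng=1$) and $h$ ($ih=n+1-i$). *)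

theory Defs
  imports "HOL-Algebra.Generated_Groups" "HOL-Algebra.Sym_Groups" Complex_Main
begin

definition PT :: "nat \<Rightarrow> (nat \<rightharpoonup> nat) set" where
  "PT n = {\<alpha>. dom \<alpha> \<subseteq> {1..n} \<and> ran \<alpha> \<subseteq> {1..n}}"

definition cycle_edges :: "nat \<Rightarrow> nat set set" where
  "cycle_edges n = {{i, i + 1} | i. 1 \<le> i \<and> i \<le> n - 1} \<union> {{1, n}}"

definition cycle_adj :: "nat \<Rightarrow> (nat \<times> nat) set" where
  "cycle_adj n = {(x, y). {x, y} \<in> cycle_edges n}"

text \<open>The geodesic distance: the least length of a walk from \<open>x\<close> to \<open>y\<close>.
  It is only meaningful for vertices \<open>x\<close>, \<open>y\<close> in \<open>{1..n}\<close>.\<close>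

definition cycle_dist :: "nat \<Rightarrow> nat \<Rightarrow> nat \<Rightarrow> nat" where
  "cycle_dist n x y = (LEAST k. (x, y) \<in> cycle_adj n ^^ k)"

definition DPC :: "nat \<Rightarrow> (nat \<rightharpoonup> nat) set" where
  "DPC n = {\<alpha> \<in> PT n. \<forall>x \<in> dom \<alpha>. \<forall>y \<in> dom \<alpha>.
     cycle_dist n (the (\<alpha> x)) (the (\<alpha> y)) = cycle_dist n x y}"

text \<open>Following \<^const>\<open>sym_group\<close>, permutations of \<open>{1..n}\<close> are total functions on
  \<^typ>\<open>nat\<close> fixing every point outside \<open>{1..n}\<close>.\<close>

definition rot :: "nat \<Rightarrow> nat \<Rightarrow> nat" where
  "rot n i = (if i \<in> {1..n} then (if i < n then i + 1 else 1) else i)"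

definition refl_perm :: "nat \<Rightarrow> nat \<Rightarrow> nat" where
  "refl_perm n i = (if i \<in> {1..n} then n + 1 - i else i)"

text \<open>\<^const>\<open>sym_group\<close> composes from right to left; since a subgroup is also a subgroup
  of the opposite group, the generated set of permutations is the same for left-to-right
  composition.\<close>

definition dihedral :: "nat \<Rightarrow> (nat \<Rightarrow> nat) set" where
  "dihedral n = generate (sym_group n) {rot n, refl_perm n}"

lemma rot_permutes: "rot n permutes {1..n}"
proof (rule bij_imp_permutes)
  show "bij_betw (rot n) {1..n} {1..n}"
    by (rule bij_betwI[where g = "\<lambda>i. if i = 1 then n else i - 1"]) (auto simp: rot_def)
qed (unfold rot_def, simp only: if_False)

lemma refl_perm_permutes: "refl_perm n permutes {1..n}"
proof (rule bij_imp_permutes)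
  show "bij_betw (refl_perm n) {1..n} {1..n}"
    by (rule bij_betwI[where g = "\<lambda>i. n + 1 - i"]) (auto simp: refl_perm_def)
qed (unfold refl_perm_def, simp only: if_False)

lemma cycle_adj_iff:
  "(x, y) \<in> cycle_adj n \<longleftrightarrow>
     (1 \<le> x \<and> x < n \<and> y = x + 1) \<or> (1 \<le> y \<and> y < n \<and> x = y + 1) \<or>
     (x = 1 \<and> y = n) \<or> (x = n \<and> y = 1)"
proof -
  have "i < n" if "1 \<le> i" "i \<le> n - 1" for i using that by linarith
  moreover have "i \<le> n - 1" if "i < n" for i using that by linarith
  ultimately show ?thesis
    unfolding cycle_adj_def cycle_edges_def by (auto simp: doubleton_eq_iff)
qed

lemma cycle_adj_sym: "(x, y) \<in> cycle_adj n ^^ k \<Longrightarrow> (y, x) \<in> cycle_adj n ^^ k"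
proof (induction k arbitrary: y)
  case (Suc k)
  then obtain z where "(x, z) \<in> cycle_adj n ^^ k" "(z, y) \<in> cycle_adj n" by auto
  with Suc.IH have "(z, x) \<in> cycle_adj n ^^ k" "(y, z) \<in> cycle_adj n"
    by (auto simp: cycle_adj_iff)
  then show ?case by (rule relpow_Suc_I2[rotated])
qed simp

lemma cycle_walk_up:
  assumes "1 \<le> x" "x + k \<le> n"
  shows "(x, x + k) \<in> cycle_adj n ^^ k"
  using assms
proof (induction k)
  case (Suc k)
  have "(x + k, x + Suc k) \<in> cycle_adj n" using Suc.prems by (auto simp: cycle_adj_iff)
  with Suc show ?case by (auto intro: relpow_Suc_I)
qed simp

lemma cycle_walk_lower:
  assumes "(x, y) \<in> cycle_adj n ^^ k" "x \<in> {1..n}"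
  shows "y \<in> {1..n} \<and> min \<bar>int x - int y\<bar> (int n - \<bar>int x - int y\<bar>) \<le> int k"
  using assms
proof (induction k arbitrary: y)
  case (Suc k)
  then obtain z where z: "(x, z) \<in> cycle_adj n ^^ k" "(z, y) \<in> cycle_adj n" by auto
  from Suc.IH[OF z(1) Suc.prems(2)] z(2) Suc.prems(2) show ?case
    unfolding cycle_adj_iff by auto
qed auto

lemma cycle_walk_exists:
  assumes "1 \<le> x" "x \<le> y" "y \<le> n"
  shows "(x, y) \<in> cycle_adj n ^^ (y - x)" "(x, y) \<in> cycle_adj n ^^ (n - (y - x))"
proof -
  show "(x, y) \<in> cycle_adj n ^^ (y - x)"
    using cycle_walk_up[of x "y - x" n] assms by simp
  have "(1, x) \<in> cycle_adj n ^^ (x - 1)"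
    using cycle_walk_up[of 1 "x - 1" n] assms by simp
  then have a: "(x, 1) \<in> cycle_adj n ^^ (x - 1)" by (rule cycle_adj_sym)
  have b: "(1, n) \<in> cycle_adj n" by (simp add: cycle_adj_iff)
  have "(y, n) \<in> cycle_adj n ^^ (n - y)"
    using cycle_walk_up[of y "n - y" n] assms by simp
  then have c: "(n, y) \<in> cycle_adj n ^^ (n - y)" by (rule cycle_adj_sym)
  from relpow_Suc_I[OF a b] c
  have "(x, y) \<in> cycle_adj n ^^ (Suc (x - 1) + (n - y))"
    unfolding relpow_add by blast
  moreover have "Suc (x - 1) + (n - y) = n - (y - x)" using assms by simp
  ultimately show "(x, y) \<in> cycle_adj n ^^ (n - (y - x))" by (simp only:)
qed

lemma cycle_dist_eq:
  assumes "x \<in> {1..n}" "y \<in> {1..n}"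
  shows "int (cycle_dist n x y) = min \<bar>int x - int y\<bar> (int n - \<bar>int x - int y\<bar>)"
proof -
  define m where "m = nat (min \<bar>int x - int y\<bar> (int n - \<bar>int x - int y\<bar>))"
  have m: "int m = min \<bar>int x - int y\<bar> (int n - \<bar>int x - int y\<bar>)"
    using assms by (auto simp: m_def)
  have "(x, y) \<in> cycle_adj n ^^ m"
  proof (cases "x \<le> y")
    case True
    then have "m = y - x \<or> m = n - (y - x)" using m assms by auto
    then show ?thesis using cycle_walk_exists[of x y n] True assms by auto
  next
    case False
    then have "m = x - y \<or> m = n - (x - y)" using m assms by auto
    then show ?thesis using cycle_walk_exists[of y x n] False assms
      by (auto intro: cycle_adj_sym)
  qed
  moreover have "m \<le> k" if "(x, y) \<in> cycle_adj n ^^ k" for k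
    using cycle_walk_lower[OF that assms(1)] m by linarith
  ultimately have "cycle_dist n x y = m"
    unfolding cycle_dist_def by (rule Least_equality)
  then show ?thesis using m by simp
qed

end

theory Submission
  imports Defs
begin

text \<open>Identify \<open>{1..n}\<close> with the integers modulo \<open>n\<close>. The dihedral group then consists of the
  affine maps \<open>i \<mapsto> s * i + c\<close> with \<open>s = \<plusminus>1\<close>, and two pairs of vertices have equal distance iff
  their differences agree up to sign modulo \<open>n\<close>. Fix \<open>a\<close> in the domain of a partial isometry
  \<open>\<alpha>\<close>: every \<open>x\<close> satisfies \<open>x\<alpha> - a\<alpha> = \<plusminus>(x - a)\<close>, and if \<open>x\<close> admitted only the sign \<open>+\<close> and \<open>y\<close>
  only the sign \<open>-\<close>, then comparing \<open>x\<alpha> - y\<alpha> = x + y - 2 * a\<close> with \<open>\<plusminus>(x - y)\<close> would give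
  \<open>2 * (y - a) = 0\<close> or \<open>2 * (x - a) = 0\<close>, so one of them would admit both signs. Hence the
  sign can be chosen uniformly, it determines the extension of \<open>\<alpha>\<close>, and both signs work iff
  \<open>2 * (x - a) = 0\<close> modulo \<open>n\<close> throughout the domain.\<close>

section \<open>Affine maps on the integers modulo \<open>n\<close>\<close>

text \<open>The shifts by 1 around \<open>mod\<close> select the representative in
  \<open>{1..n}\<close> rather than \<open>{0..n-1}\<close>. Fixing all other points follows the
  convention of \<open>sym_group\<close>.\<close>

definition affine_perm :: "nat \<Rightarrow> int \<Rightarrow> int \<Rightarrow> nat \<Rightarrow> nat" where
  "affine_perm n s c i = (if i \<in> {1..n} then nat ((s * int i + c - 1) mod int n) + 1 else i)"

lemma affine_perm_range: "i \<in> {1..n} \<Longrightarrow> affine_perm n s c i \<in> {1..n}"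
proof -
  assume i: "i \<in> {1..n}"
  then have "(s * int i + c - 1) mod int n \<ge> 0" "(s * int i + c - 1) mod int n < int n" by simp_all
  then show ?thesis using i by (simp add: affine_perm_def nat_less_iff Suc_le_eq)
qed

lemma eq_if_dvd_diff:
  assumes "i \<in> {1..n}" "j \<in> {1..n}" "int n dvd int i - int j"
  shows "i = j"
  using assms zdvd_not_zless[of "int i - int j" "int n"] zdvd_not_zless[of "int j - int i" "int n"]
  by (auto simp: dvd_diff_commute)
    (metis atLeastAtMost_iff dvd_diff_commute linorder_neqE_nat diff_gt_0_iff_gt of_nat_less_iff)

text \<open>Each residue class has just one member in \<open>{1..n}\<close>. This replaces
  evaluation by divisibility, so that later computations are linear combinations of
  congruences.\<close>

lemma affine_perm_eq_iff:
  assumes "i \<in> {1..n}" "j \<in> {1..n}"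
  shows "affine_perm n s c i = j \<longleftrightarrow> int n dvd s * int i + c - int j"
proof -
  let ?p = "affine_perm n s c i"
  have "int ?p = (s * int i + c - 1) mod int n + 1"
    using assms by (simp add: affine_perm_def)
  moreover have "int n dvd (s * int i + c - 1) - (s * int i + c - 1) mod int n"
    by (rule dvd_minus_mod)
  ultimately have *: "int n dvd s * int i + c - int ?p" by (simp add: algebra_simps)
  show ?thesis
  proof
    assume "int n dvd s * int i + c - int j"
    from dvd_diff[OF this *] have "int n dvd int ?p - int j" by (simp add: algebra_simps)
    with assms show "?p = j" using eq_if_dvd_diff affine_perm_range by blast
  qed (use * in auto)
qed

lemma affine_perm_dvd:
  assumes "i \<in> {1..n}"
  shows "int n dvd s * int i + c - int (affine_perm n s c i)"
  using affine_perm_eq_iff[OF assms affine_perm_range[OF assms]] by blast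

lemma affine_perm_comp:
  "affine_perm n s c \<circ> affine_perm n s' c' = affine_perm n (s * s') (s * c' + c)"
proof
  fix i
  show "(affine_perm n s c \<circ> affine_perm n s' c') i = affine_perm n (s * s') (s * c' + c) i"
  proof (cases "i \<in> {1..n}")
    case True
    let ?j = "affine_perm n s' c' i"
    have j: "?j \<in> {1..n}" using True by (rule affine_perm_range)
    let ?k = "affine_perm n s c ?j"
    \<comment> \<open>Scaling the inner congruence by \<open>s\<close> makes the intermediate value
      \<open>?j\<close> cancel.\<close>
    have "int n dvd s * (s' * int i + c' - int ?j) + (s * int ?j + c - int ?k)"
      by (intro dvd_add dvd_mult affine_perm_dvd True j)
    then have "int n dvd s * s' * int i + (s * c' + c) - int ?k" by (simp add: algebra_simps)
    then show ?thesis
      using affine_perm_eq_iff[OF True affine_perm_range[OF j]] by (metis comp_apply)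
  next
    case False
    then show ?thesis by (simp only: comp_apply affine_perm_def if_False)
  qed
qed

lemma affine_perm_id: "affine_perm n 1 0 = id"
proof
  fix i show "affine_perm n 1 0 i = id i"
    using affine_perm_eq_iff[of i n i 1 0] by (cases "i \<in> {1..n}") (auto simp: affine_perm_def)
qed

lemma rot_eq_affine_perm: "rot n = affine_perm n 1 1"
proof
  fix i
  show "rot n i = affine_perm n 1 1 i"
  proof (cases "i \<in> {1..n}")
    case True
    then have "rot n i \<in> {1..n}" "int n dvd 1 * int i + 1 - int (rot n i)"
      by (auto simp: rot_def)
    then show ?thesis using affine_perm_eq_iff[OF True] by metis
  qed (simp only: rot_def affine_perm_def if_False)
qed

lemma refl_perm_eq_affine_perm: "refl_perm n = affine_perm n (-1) 1"
proof
  fix i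
  show "refl_perm n i = affine_perm n (-1) 1 i"
  proof (cases "i \<in> {1..n}")
    case True
    then have "refl_perm n i \<in> {1..n}" "int n dvd (-1) * int i + 1 - int (refl_perm n i)"
      by (auto simp: refl_perm_def of_nat_diff)
    then show ?thesis using affine_perm_eq_iff[OF True] by metis
  qed (simp only: refl_perm_def affine_perm_def if_False)
qed

lemma affine_perm_cong:
  assumes "int n dvd c - c'"
  shows "affine_perm n s c = affine_perm n s c'"
proof
  fix i
  show "affine_perm n s c i = affine_perm n s c' i"
  proof (cases "i \<in> {1..n}")
    case True
    from dvd_add[OF assms affine_perm_dvd[OF True, of s c']]
    have "int n dvd s * int i + c - int (affine_perm n s c' i)" by (simp add: algebra_simps)
    then show ?thesis using affine_perm_eq_iff[OF True affine_perm_range[OF True]] by blast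
  qed (simp only: affine_perm_def if_False)
qed

section \<open>The dihedral group as a group of affine maps\<close>

lemma rotation_in_dihedral: "affine_perm n 1 (int k) \<in> dihedral n"
proof (induction k)
  case 0
  have "\<one>\<^bsub>sym_group n\<^esub> \<in> dihedral n" unfolding dihedral_def by (rule generate.one)
  then show ?case by (simp add: affine_perm_id sym_group_def id_def)
next
  case (Suc k)
  have "rot n \<in> dihedral n" by (auto simp: dihedral_def intro: generate.incl)
  from generate.eng[OF Suc[unfolded dihedral_def] this[unfolded dihedral_def]]
  show ?case
    by (simp add: dihedral_def sym_group_def rot_eq_affine_perm affine_perm_comp add.commute)
qed

text \<open>The affine maps with sign 1 or -1 contain the generators and their inverses and are
  closed under composition. Conversely, those of sign 1 are powers of \<open>rot\<close>, and those
  of sign -1 are such powers composed with \<open>refl_perm\<close>.\<close>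

lemma dihedral_eq:
  assumes "n > 0"
  shows "dihedral n = {affine_perm n s c | s c. s \<in> {1, -1}}"
proof (intro equalityI subsetI)
  fix \<sigma> assume "\<sigma> \<in> dihedral n"
  then show "\<sigma> \<in> {affine_perm n s c | s c. s \<in> {1, -1}}"
    unfolding dihedral_def
  proof (induction rule: generate.induct)
    case one
    then show ?case by (force simp: sym_group_def affine_perm_id[of n, symmetric])
  next
    case (incl h)
    then show ?case by (auto simp: rot_eq_affine_perm refl_perm_eq_affine_perm)
  next
    case (inv h)
    have "group (sym_group n)" by (rule sym_group_is_group)
    moreover have "h \<in> carrier (sym_group n)"
      using inv rot_permutes refl_perm_permutes by (auto simp: sym_group_def)
    \<comment> \<open>Left inverses in a group are unique, so it suffices to exhibit an affine one
      in the carrier.\<close>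
    ultimately have *: "g \<in> carrier (sym_group n) \<Longrightarrow> g \<circ> h = id \<Longrightarrow> inv\<^bsub>sym_group n\<^esub> h = g" for g
      by (intro group.inv_equality) (auto simp: sym_group_def)
    show ?case
    proof (cases "h = rot n")
      case True
      have r: "rot n \<circ> affine_perm n 1 (-1) = id" "affine_perm n 1 (-1) \<circ> rot n = id"
        by (simp_all add: rot_eq_affine_perm affine_perm_comp affine_perm_id)
      \<comment> \<open>Being the inverse of a permutation puts the backward rotation in the
        carrier.\<close>
      have "affine_perm n 1 (-1) = inv_into UNIV (rot n)"
        using r by (metis inv_unique_comp)
      then have "affine_perm n 1 (-1) \<in> carrier (sym_group n)"
        using rot_permutes[of n] by (simp add: sym_group_def permutes_inv)
      from *[OF this] r True show ?thesis by auto
    next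
      case False
      then have h: "h = refl_perm n" using inv by simp
      then have "h \<circ> h = id" by (simp add: refl_perm_eq_affine_perm affine_perm_comp affine_perm_id)
      from *[OF \<open>h \<in> carrier (sym_group n)\<close> this] h show ?thesis
        by (auto simp: refl_perm_eq_affine_perm)
    qed
  next
    case (eng h1 h2)
    then obtain s c s' c' where "h1 = affine_perm n s c" "h2 = affine_perm n s' c'"
      "s \<in> {1, -1}" "s' \<in> {1, -1}" by blast
    then have "h1 \<otimes>\<^bsub>sym_group n\<^esub> h2 = affine_perm n (s * s') (s * c' + c)" "s * s' \<in> {1, -1}"
      by (auto simp: sym_group_def affine_perm_comp)
    then show ?case by blast
  qed
next
  fix \<sigma> assume "\<sigma> \<in> {affine_perm n s c | s c. s \<in> {1, -1}}"
  then obtain s c where \<sigma>: "\<sigma> = affine_perm n s c" "s \<in> {1, -1}" by blast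
  have rotation: "affine_perm n 1 c \<in> dihedral n" for c
  proof -
    \<comment> \<open>Reducing modulo \<open>n\<close> turns an arbitrary integer shift into a
      natural exponent of \<open>rot\<close>.\<close>
    have "int n dvd c - int (nat (c mod int n))" using assms by (simp add: dvd_minus_mod)
    then have "affine_perm n 1 c = affine_perm n 1 (int (nat (c mod int n)))"
      by (rule affine_perm_cong)
    then show ?thesis using rotation_in_dihedral by metis
  qed
  have "refl_perm n \<in> dihedral n" by (auto simp: dihedral_def intro: generate.incl)
  from generate.eng[OF rotation[unfolded dihedral_def] this[unfolded dihedral_def]]
  have "affine_perm n (-1) (1 + c) \<in> dihedral n" for c
    by (simp add: dihedral_def sym_group_def refl_perm_eq_affine_perm affine_perm_comp)
  \<comment> \<open>The shift \<open>c - 1\<close> compensates for the constant 1 in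
    \<open>refl_perm\<close>.\<close>
  from this[of "c - 1"] rotation[of c] \<sigma> show "\<sigma> \<in> dihedral n" by auto
qed

text \<open>Here n \<ge> 3 enters: agreement at the points 1 and 2 would force \<open>n\<close> to
  divide 2.\<close>

lemma affine_perm_sign_neq:
  assumes "n \<ge> 3"
  shows "affine_perm n 1 c \<noteq> affine_perm n (-1) c'"
proof
  assume eq: "affine_perm n 1 c = affine_perm n (-1) c'"
  have *: "int n dvd 2 * int i + (c - c')" if "i \<in> {1..n}" for i
    using dvd_diff[OF affine_perm_dvd[OF that, of 1 c] affine_perm_dvd[OF that, of "-1" c']]
    by (simp add: eq algebra_simps)
  have "int n dvd 2" using dvd_diff[OF *[of 2] *[of 1]] assms by simp
  then show False using assms zdvd_imp_le[of "int n" 2] by simp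
qed

section \<open>Distances expressed by congruences\<close>

lemma cycle_dist_eq_iff:
  assumes "x \<in> {1..n}" "y \<in> {1..n}" "u \<in> {1..n}" "v \<in> {1..n}"
  shows "cycle_dist n u v = cycle_dist n x y \<longleftrightarrow>
    int n dvd (int u - int v) - (int x - int y) \<or> int n dvd (int u - int v) + (int x - int y)"
    (is "?D \<longleftrightarrow> ?R")
proof -
  define p q N where "p = int x - int y" and "q = int u - int v" and "N = int n"
  have b: "\<bar>p\<bar> < N" "\<bar>q\<bar> < N" using assms by (auto simp: p_def q_def N_def)
  \<comment> \<open>Since \<open>p\<close> and \<open>q\<close> are less than \<open>N\<close> in
    absolute value, their sum and difference can only be these multiples of
    \<open>N\<close>.\<close>
  have small: "m = 0 \<or> m = N \<or> m = - N" if dvd: "N dvd m" and less: "\<bar>m\<bar> < 2 * N" for m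
  proof -
    from dvd obtain k where k: "m = N * k" by blast
    have "N * \<bar>k\<bar> < N * 2" using less b by (simp add: k abs_mult)
    then have "\<bar>k\<bar> < 2" using b by (simp add: mult_less_cancel_left)
    then have "k = 0 \<or> k = 1 \<or> k = -1" by auto
    then show ?thesis using k by auto
  qed
  have "?D \<longleftrightarrow> int (cycle_dist n u v) = int (cycle_dist n x y)" by simp
  also have "\<dots> \<longleftrightarrow> min \<bar>q\<bar> (N - \<bar>q\<bar>) = min \<bar>p\<bar> (N - \<bar>p\<bar>)"
    unfolding cycle_dist_eq[OF assms(1,2)] cycle_dist_eq[OF assms(3,4)] p_def q_def N_def ..
  \<comment> \<open>The minima agree iff |q| = |p| or |q| + |p| = N.\<close>
  also have "\<dots> \<longleftrightarrow> q - p \<in> {0, N, -N} \<or> q + p \<in> {0, N, -N}" using b by auto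
  also have "\<dots> \<longleftrightarrow> N dvd q - p \<or> N dvd q + p"
    using small[of "q - p"] small[of "q + p"] b by auto
  finally show ?thesis by (simp add: p_def q_def N_def)
qed

text \<open>A nonzero difference \<open>p\<close> with |p| < N has \<open>2 * p\<close> divisible by
  \<open>N\<close> only if 2|p| = N. Thus the condition for both signs to fit means that the points
  coincide or are antipodal.\<close>

lemma dvd_double_diff_iff:
  assumes "x \<in> {1..n}" "y \<in> {1..n}"
  shows "int n dvd 2 * (int x - int y) \<longleftrightarrow> x = y \<or> 2 * cycle_dist n x y = n"
proof (cases "x = y")
  case False
  define p N where "p = int x - int y" and "N = int n"
  have b: "\<bar>p\<bar> < N" "p \<noteq> 0" using assms False by (auto simp: p_def N_def)
  have "N dvd 2 * p \<longleftrightarrow> 2 * \<bar>p\<bar> = N"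
  proof
    assume "N dvd 2 * p"
    then obtain k where k: "2 * p = N * k" by blast
    have "N * \<bar>k\<bar> = 2 * \<bar>p\<bar>" using arg_cong[OF k, of abs] b by (simp add: abs_mult)
    moreover from this have "N * \<bar>k\<bar> < N * 2" "k \<noteq> 0" using b by auto
    moreover from this have "\<bar>k\<bar> < 2" using b by (simp add: mult_less_cancel_left)
    ultimately have "\<bar>k\<bar> = 1" by linarith
    then show "2 * \<bar>p\<bar> = N" using \<open>N * \<bar>k\<bar> = 2 * \<bar>p\<bar>\<close> by simp
  next
    assume "2 * \<bar>p\<bar> = N"
    then have "N dvd \<bar>2 * p\<bar>" by (simp add: abs_mult)
    then show "N dvd 2 * p" by simp
  qed
  also have "\<dots> \<longleftrightarrow> 2 * int (cycle_dist n x y) = N"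
    unfolding cycle_dist_eq[OF assms] p_def N_def by (auto simp: min_def split: if_splits)
  also have "\<dots> \<longleftrightarrow> 2 * cycle_dist n x y = n" unfolding N_def by linarith
  finally show ?thesis using False by (simp add: p_def N_def)
qed simp

section \<open>Extensions of a partial map by affine maps, and their number\<close>

definition extends :: "(nat \<Rightarrow> nat) \<Rightarrow> (nat \<rightharpoonup> nat) \<Rightarrow> bool" where
  "extends \<sigma> \<alpha> \<longleftrightarrow> \<alpha> = (Some \<circ> \<sigma>) |` dom \<alpha>"

lemma extends_affine_perm_iff:
  assumes "\<alpha> \<in> PT n"
  shows "extends (affine_perm n s c) \<alpha> \<longleftrightarrow> (\<forall>x\<in>dom \<alpha>. int n dvd s * int x + c - int (the (\<alpha> x)))"
proof -
  have "extends \<sigma> \<alpha> \<longleftrightarrow> (\<forall>x\<in>dom \<alpha>. \<sigma> x = the (\<alpha> x))" for \<sigma>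
    unfolding extends_def fun_eq_iff restrict_map_def by (auto simp: dom_def)
  moreover have "x \<in> {1..n} \<and> the (\<alpha> x) \<in> {1..n}" if "x \<in> dom \<alpha>" for x
    using that assms unfolding PT_def by (auto simp: ran_def)
  ultimately show ?thesis using affine_perm_eq_iff by auto
qed

text \<open>The value at \<open>a\<close> dictates the shift, so only the sign has to be
  found.\<close>

lemma DPC_imp_uniform_sign:
  assumes "\<alpha> \<in> DPC n" "a \<in> dom \<alpha>"
  obtains s where "s \<in> {1, -1}"
    "extends (affine_perm n s (int (the (\<alpha> a)) - s * int a)) \<alpha>"
proof -
  let ?f = "\<lambda>x. int (the (\<alpha> x))"
  have PT: "\<alpha> \<in> PT n" using assms by (simp add: DPC_def)
  have iso: "int n dvd (?f x - ?f y) - (int x - int y) \<or> int n dvd (?f x - ?f y) + (int x - int y)"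
    if "x \<in> dom \<alpha>" "y \<in> dom \<alpha>" for x y
  proof -
    have "x \<in> {1..n}" "y \<in> {1..n}" "the (\<alpha> x) \<in> {1..n}" "the (\<alpha> y) \<in> {1..n}"
      using that PT unfolding PT_def by (auto simp: ran_def)
    moreover have "cycle_dist n (the (\<alpha> x)) (the (\<alpha> y)) = cycle_dist n x y"
      using that assms(1) by (simp add: DPC_def)
    ultimately show ?thesis by (simp add: cycle_dist_eq_iff)
  qed
  let ?P = "\<lambda>x. int n dvd (?f x - ?f a) - (int x - int a)"
  let ?M = "\<lambda>x. int n dvd (?f x - ?f a) + (int x - int a)"
  have "(\<forall>x\<in>dom \<alpha>. ?P x) \<or> (\<forall>x\<in>dom \<alpha>. ?M x)"
  proof (rule ccontr)
    assume "\<not> ?thesis"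
    then obtain x y where xy: "x \<in> dom \<alpha>" "y \<in> dom \<alpha>" "\<not> ?P y" "\<not> ?M x" by blast
    with iso assms(2) have PM: "?P x" "?M y" by blast+
    from iso[OF xy(1,2)] show False
    proof
      assume "int n dvd (?f x - ?f y) - (int x - int y)"
      \<comment> \<open>All values of \<alpha> cancel, leaving 2(y - a). Subtracting this from
        \<open>?M y\<close> gives \<open>?P y\<close>; the other case yields \<open>?M x\<close> in
        the same way.\<close>
      from dvd_add[OF this dvd_diff[OF PM(2) PM(1)]]
      have d: "int n dvd 2 * (int y - int a)" by (simp add: algebra_simps)
      from dvd_diff[OF PM(2) d] xy(3) show False by (simp add: algebra_simps)
    next
      assume "int n dvd (?f x - ?f y) + (int x - int y)"
      from dvd_add[OF this dvd_diff[OF PM(2) PM(1)]]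
      have d: "int n dvd 2 * (int x - int a)" by (simp add: algebra_simps)
      from dvd_add[OF PM(1) d] xy(4) show False by (simp add: algebra_simps)
    qed
  qed
  moreover have "extends (affine_perm n 1 (?f a - 1 * int a)) \<alpha>" if "\<forall>x\<in>dom \<alpha>. ?P x"
    unfolding extends_affine_perm_iff[OF PT]
  proof
    fix x assume "x \<in> dom \<alpha>"
    with that have "int n dvd - ((?f x - ?f a) - (int x - int a))" by (metis dvd_minus_iff)
    then show "int n dvd 1 * int x + (?f a - 1 * int a) - ?f x" by (simp add: algebra_simps)
  qed
  moreover have "extends (affine_perm n (-1) (?f a - (-1) * int a)) \<alpha>" if "\<forall>x\<in>dom \<alpha>. ?M x"
    unfolding extends_affine_perm_iff[OF PT]
  proof
    fix x assume "x \<in> dom \<alpha>"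
    with that have "int n dvd - ((?f x - ?f a) + (int x - int a))" by (metis dvd_minus_iff)
    then show "int n dvd (-1) * int x + (?f a - (-1) * int a) - ?f x" by (simp add: algebra_simps)
  qed
  ultimately show thesis using that by blast
qed

text \<open>Subtracting the congruences at two points removes \<open>c\<close>, and distances do not
  see the remaining sign.\<close>

lemma extends_imp_DPC:
  assumes "\<alpha> \<in> PT n" "extends (affine_perm n s c) \<alpha>" "s \<in> {1, -1}"
  shows "\<alpha> \<in> DPC n"
  unfolding DPC_def
proof (intro CollectI conjI ballI assms(1))
  fix x y assume xy: "x \<in> dom \<alpha>" "y \<in> dom \<alpha>"
  let ?f = "\<lambda>x. int (the (\<alpha> x))"
  have r: "x \<in> {1..n}" "y \<in> {1..n}" "the (\<alpha> x) \<in> {1..n}" "the (\<alpha> y) \<in> {1..n}"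
    using xy assms(1) unfolding PT_def by (auto simp: ran_def)
  have "int n dvd s * int x + c - ?f x" "int n dvd s * int y + c - ?f y"
    using assms(2) xy unfolding extends_affine_perm_iff[OF assms(1)] by auto
  from dvd_diff[OF this(2,1)]
  have "int n dvd (?f x - ?f y) - s * (int x - int y)" by (simp add: algebra_simps)
  then show "cycle_dist n (the (\<alpha> x)) (the (\<alpha> y)) = cycle_dist n x y"
    unfolding cycle_dist_eq_iff[OF r] using assms(3) by (auto simp: algebra_simps)
qed

text \<open>The congruence at \<open>a\<close> fixes the shift modulo \<open>n\<close>, which leaves
  at most one candidate for each sign.\<close>

lemma extensions_eq:
  assumes "n > 0" "\<alpha> \<in> PT n" "a \<in> dom \<alpha>"
  shows "{\<sigma> \<in> dihedral n. extends \<sigma> \<alpha>} =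
    {\<sigma>. \<exists>s\<in>{1, -1}. \<sigma> = affine_perm n s (int (the (\<alpha> a)) - s * int a) \<and> extends \<sigma> \<alpha>}"
proof -
  have "affine_perm n s c = affine_perm n s (int (the (\<alpha> a)) - s * int a)"
    if "extends (affine_perm n s c) \<alpha>" for s c
  proof (rule affine_perm_cong)
    show "int n dvd c - (int (the (\<alpha> a)) - s * int a)"
      using that assms(3) unfolding extends_affine_perm_iff[OF assms(2)]
      by (auto simp: algebra_simps)
  qed
  then show ?thesis unfolding dihedral_eq[OF assms(1)] by blast
qed

text \<open>One sign works because \<alpha> is a partial isometry. At each \<open>x\<close> the
  conditions for the two signs differ by 2(x - a), so the other sign works exactly when all these
  are divisible by \<open>n\<close>.\<close>

lemma both_signs_iff:
  assumes "n > 0" "\<alpha> \<in> DPC n" "a \<in> dom \<alpha>"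
  shows "(\<forall>s\<in>{1, -1}. extends (affine_perm n s (int (the (\<alpha> a)) - s * int a)) \<alpha>) \<longleftrightarrow>
    (\<forall>x\<in>dom \<alpha>. int n dvd 2 * (int x - int a))"
    (is "(\<forall>s\<in>_. ?E s) \<longleftrightarrow> _")
proof -
  let ?d = "\<lambda>s x. s * int x + (int (the (\<alpha> a)) - s * int a) - int (the (\<alpha> x))"
  have PT: "\<alpha> \<in> PT n" using assms by (simp add: DPC_def)
  have E: "?E s \<longleftrightarrow> (\<forall>x\<in>dom \<alpha>. int n dvd ?d s x)" for s
    by (rule extends_affine_perm_iff[OF PT])
  have d: "?d 1 x = ?d (-1) x + 2 * (int x - int a)" for x by simp
  obtain s where "s \<in> {1, -1}" "?E s" using DPC_imp_uniform_sign[OF assms(2,3)] by blast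
  then consider "?E 1" | "?E (-1)" by blast
  then show ?thesis
  proof cases
    case 1
    then have "?E (-1) \<longleftrightarrow> (\<forall>x\<in>dom \<alpha>. int n dvd 2 * (int x - int a))"
      unfolding E d by (metis dvd_add_right_iff dvd_add_left_iff)
    with 1 show ?thesis by simp
  next
    case 2
    then have "?E 1 \<longleftrightarrow> (\<forall>x\<in>dom \<alpha>. int n dvd 2 * (int x - int a))"
      unfolding E d by (metis dvd_add_right_iff)
    with 2 show ?thesis by simp
  qed
qed

text \<open>At least one of two distinct candidates extends \<alpha>, so the count only depends on
  whether both do.\<close>

lemma card_extensions:
  assumes "n \<ge> 3" "\<alpha> \<in> DPC n" "a \<in> dom \<alpha>"
  shows "card {\<sigma> \<in> dihedral n. extends \<sigma> \<alpha>} =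
    (if \<forall>x\<in>dom \<alpha>. int n dvd 2 * (int x - int a) then 2 else 1)"
proof -
  let ?p = "\<lambda>s. affine_perm n s (int (the (\<alpha> a)) - s * int a)"
  have n: "n > 0" and PT: "\<alpha> \<in> PT n" using assms by (simp_all add: DPC_def)
  have neq: "?p 1 \<noteq> ?p (-1)" using affine_perm_sign_neq[OF assms(1)] by blast
  have ex: "extends (?p 1) \<alpha> \<or> extends (?p (-1)) \<alpha>"
    using DPC_imp_uniform_sign[OF assms(2,3)] by blast
  have iff: "extends (?p 1) \<alpha> \<and> extends (?p (-1)) \<alpha> \<longleftrightarrow>
    (\<forall>x\<in>dom \<alpha>. int n dvd 2 * (int x - int a))"
    using both_signs_iff[OF n assms(2,3)] by simp
  have S: "{\<sigma> \<in> dihedral n. extends \<sigma> \<alpha>} =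
      (if extends (?p 1) \<alpha> then {?p 1} else {}) \<union> (if extends (?p (-1)) \<alpha> then {?p (-1)} else {})"
    unfolding extensions_eq[OF n PT assms(3)] by auto
  show ?thesis unfolding S iff[symmetric] using ex neq by auto
qed

section \<open>From divisibility to the size of the domain and antipodal points\<close>

theorem lemma1p1:
  fixes n :: nat and \<alpha> :: "nat \<rightharpoonup> nat"
  assumes "n \<ge> 3" and "\<alpha> \<in> PT n"
  shows "(\<alpha> \<in> DPC n \<longleftrightarrow> (\<exists>\<sigma> \<in> dihedral n. \<alpha> = (Some \<circ> \<sigma>) |` dom \<alpha>)) \<and>
    (\<alpha> \<in> DPC n \<longrightarrow>
      (card (dom \<alpha>) = 2 \<and>
         real (cycle_dist n (Min (dom \<alpha>)) (Max (dom \<alpha>))) = real n / 2 \<longrightarrow> even n) \<and>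
      (card (dom \<alpha>) = 1 \<or>
       card (dom \<alpha>) = 2 \<and>
         real (cycle_dist n (Min (dom \<alpha>)) (Max (dom \<alpha>))) = real n / 2 \<longrightarrow>
       card {\<sigma> \<in> dihedral n. \<alpha> = (Some \<circ> \<sigma>) |` dom \<alpha>} = 2) \<and>
      (card (dom \<alpha>) = 2 \<and>
         real (cycle_dist n (Min (dom \<alpha>)) (Max (dom \<alpha>))) \<noteq> real n / 2 \<or>
       card (dom \<alpha>) \<ge> 3 \<longrightarrow>
       (\<exists>!\<sigma>. \<sigma> \<in> dihedral n \<and> \<alpha> = (Some \<circ> \<sigma>) |` dom \<alpha>)))"
proof -
  let ?A = "dom \<alpha>"
  have n: "n > 0" using assms by simp
  have A: "?A \<subseteq> {1..n}" "finite ?A"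
    using assms(2) by (auto simp: PT_def intro: finite_subset[OF _ finite_atLeastAtMost])
  have 1: "\<alpha> \<in> DPC n \<longleftrightarrow> (\<exists>\<sigma>\<in>dihedral n. extends \<sigma> \<alpha>)"
  proof
    assume D: "\<alpha> \<in> DPC n"
    show "\<exists>\<sigma>\<in>dihedral n. extends \<sigma> \<alpha>"
    proof (cases "?A = {}")
      case True
      \<comment> \<open>With an empty domain there is no base point, and the identity serves as
        extension.\<close>
      have "affine_perm n 1 0 \<in> dihedral n" unfolding dihedral_eq[OF n] by blast
      moreover have "extends (affine_perm n 1 0) \<alpha>"
        unfolding extends_affine_perm_iff[OF assms(2)] True by simp
      ultimately show ?thesis by blast
    next
      case False
      then obtain a where "a \<in> ?A" by blast
      from DPC_imp_uniform_sign[OF D this] show ?thesis unfolding dihedral_eq[OF n] by blast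
    qed
  next
    assume "\<exists>\<sigma>\<in>dihedral n. extends \<sigma> \<alpha>"
    then show "\<alpha> \<in> DPC n" unfolding dihedral_eq[OF n] using extends_imp_DPC[OF assms(2)] by blast
  qed
  let ?d = "cycle_dist n (Min ?A) (Max ?A)"
  have half: "real ?d = real n / 2 \<longleftrightarrow> 2 * ?d = n" by linarith
  have 2: "card {\<sigma> \<in> dihedral n. extends \<sigma> \<alpha>} = 2"
    if D: "\<alpha> \<in> DPC n" and c: "card ?A = 1 \<or> card ?A = 2 \<and> 2 * ?d = n"
  proof -
    have ne: "?A \<noteq> {}" using c by auto
    \<comment> \<open>With the maximum as base point, the other point of a two-element domain is the
      minimum, as in the distance \<open>?d\<close>.\<close>
    let ?a = "Max ?A"
    have M: "?a \<in> ?A" "Min ?A \<in> ?A" using A ne by simp_all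
    have "\<forall>x\<in>?A. x = ?a \<or> x = Min ?A \<and> 2 * ?d = n"
    proof (cases "card ?A = 1")
      case True
      then obtain b where "?A = {b}" by (auto simp: card_1_singleton_iff)
      with M(1) show ?thesis by (metis singletonD)
    next
      case False
      with c have "card ?A = 2" "2 * ?d = n" by auto
      moreover from this obtain u v where "?A = {u, v}" by (auto simp: card_2_iff)
      ultimately show ?thesis by (auto simp: min_def max_def simp del: domIff)
    qed
    then have "\<forall>x\<in>?A. int n dvd 2 * (int x - int ?a)"
      using dvd_double_diff_iff M A by blast
    then show ?thesis using card_extensions[OF assms(1) D M(1)] by simp
  qed
  have 3: "\<exists>!\<sigma>. \<sigma> \<in> dihedral n \<and> extends \<sigma> \<alpha>"
    if D: "\<alpha> \<in> DPC n" and c: "card ?A = 2 \<and> 2 * ?d \<noteq> n \<or> card ?A \<ge> 3"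
  proof -
    have ne: "?A \<noteq> {}" using c by auto
    let ?a = "Max ?A"
    have M: "?a \<in> ?A" "Min ?A \<in> ?A" using A ne by simp_all
    have "\<not> (\<forall>x\<in>?A. int n dvd 2 * (int x - int ?a))"
    proof
      assume *: "\<forall>x\<in>?A. int n dvd 2 * (int x - int ?a)"
      \<comment> \<open>Each other point of the domain is antipodal to the maximum and lies below
        it, hence equals ?a - n/2. So there is at most one such point, which rules out three
        elements.\<close>
      have opp: "2 * (int ?a - int x) = int n" if "x \<in> ?A" "x \<noteq> ?a" for x
      proof -
        have x: "x \<in> {1..n}" "?a \<in> {1..n}" "x \<le> ?a" using that M A by auto
        then have "2 * cycle_dist n x ?a = n" using * dvd_double_diff_iff that by blast
        then show ?thesis using cycle_dist_eq[OF x(1,2)] x by (auto simp: min_def split: if_splits)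
      qed
      then have sub: "?A \<subseteq> {Min ?A, ?a}"
      proof (intro subsetI)
        fix x assume "x \<in> ?A"
        show "x \<in> {Min ?A, ?a}"
        proof (rule ccontr)
          assume "x \<notin> {Min ?A, ?a}"
          moreover have "Min ?A \<le> x" "x \<le> ?a" using A \<open>x \<in> ?A\<close> by simp_all
          ultimately show False using opp[of x] opp[of "Min ?A"] M \<open>x \<in> ?A\<close> by auto
        qed
      qed
      have card: "card ?A \<le> 2"
        using card_mono[OF _ sub] card_insert_le_m1[of 2 "{?a}" "Min ?A"] by simp
      then have "card ?A = 2" "2 * ?d \<noteq> n" using c by auto
      moreover have "Min ?A \<noteq> ?a"
      proof
        assume "Min ?A = ?a"
        then have "card ?A \<le> 1" using card_mono[OF _ sub] by simp
        with \<open>card ?A = 2\<close> show False by simp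
      qed
      \<comment> \<open>In the remaining two-element case this makes minimum and maximum antipodal,
        against 2 * ?d \<noteq> n.\<close>
      moreover have "int n dvd 2 * (int (Min ?A) - int ?a)" using * M by blast
      ultimately show False using dvd_double_diff_iff M A by blast
    qed
    then have "card {\<sigma> \<in> dihedral n. extends \<sigma> \<alpha>} = 1"
      using card_extensions[OF assms(1) D M(1)] by simp
    then obtain \<tau> where "{\<sigma> \<in> dihedral n. extends \<sigma> \<alpha>} = {\<tau>}"
      by (auto simp: card_1_singleton_iff)
    then have "\<sigma> \<in> dihedral n \<and> extends \<sigma> \<alpha> \<longleftrightarrow> \<sigma> = \<tau>" for \<sigma>
      by (simp add: set_eq_iff)
    then show ?thesis by simp
  qed
  have even: "even n" if "2 * ?d = n" using that by (metis dvd_triv_left)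
  show ?thesis unfolding half extends_def[symmetric] using 1 2 3 even by blast
qed

end
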